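(* Let $0<\alpha\le1$ and let $X$ be a super-reflexive Banach space that has an equivalent norm with modulus of smoothness of power type $1+\alpha$. Let $U\subset X$ be an open quasiconvex set and $f\in C^{1,\alpha}(U)$. Then $f$ can be extended to a function $F\in C^{1,\alpha}(X)$.
   Context: All normed linear spaces are real and $Df$ denotes the Fréchet derivative. For an open subset $U$ of a normed linear space and $0<\alpha\le1$, $C^{1,\alpha}(U)$ is the set of all Fréchet differentiable $f\colon U\to\mathbb R$ such that $Df$ is $\alpha$-Hölder on $U$, i.e. there is $C>0$ with $\|Df(x)-Df(y)\|\le C\|x-y\|^\alpha$ for all $x,y\in U$. A metric space $(Z,\rho)$ is $c$-quasiconvex ($c\ge1$) if for each $x,y\in Z$ there is a continuous rectifiable curve $\gamma\colon[0,1]\to Z$ with $\gamma(0)=x$, $\gamma(1)=y$ and length (variation) at most $c\rho(x,y)$; it is quasiconvex if it is $c$-quasiconvex for some $c\ge1$. Subsets of normed spaces carry the norm metric. The modulus of smoothness of a norm $\|\cdot\|$ on $X$ is $\rho(\tau)=\sup\{\frac{\|x+\tau y\|+\|x-\tau y\|}{2}-1 : x,y\in X,\ \|x\|=\|y\|=1\}$, $\tau\ge0$; it is of power type $p>1$ if there is $K>0$ with $\rho(\tau)\le K\tau^p$ for all $\tau\ge0$. A Banach space is super-reflexive if and only if it has an equivalent uniformly smooth norm. *)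

theory Defs
  imports "HOL-Analysis.Analysis"
begin

section \<open>Functions with Hoelder continuous derivative\<close>

text \<open>Functions are total, so membership in \<open>C1_holder \<alpha> U\<close> restricts only the values on \<open>U\<close>.
  It is meant for open \<open>U\<close>, where \<open>at x\<close> gives the Frechet derivative of the restriction
  to \<open>U\<close>. The norm of \<open>f' x - f' y\<close> is the operator norm.\<close>

definition C1_holder :: "real \<Rightarrow> 'a::real_normed_vector set \<Rightarrow> ('a \<Rightarrow> real) set" where
  "C1_holder \<alpha> U = {f. \<exists>f' :: 'a \<Rightarrow> ('a \<Rightarrow>\<^sub>L real).
      (\<forall>x\<in>U. (f has_derivative blinfun_apply (f' x)) (at x)) \<and>
      (\<exists>C>0. \<forall>x\<in>U. \<forall>y\<in>U. norm (f' x - f' y) \<le> C * norm (x - y) powr \<alpha>)}"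

section \<open>Quasiconvex sets\<close>

definition variation_sums :: "(real \<Rightarrow> 'a::metric_space) \<Rightarrow> real set" where
  "variation_sums \<gamma> = {(\<Sum>i<n. dist (\<gamma> (t i)) (\<gamma> (t (Suc i)))) | (n::nat) (t::nat \<Rightarrow> real).
      t 0 = 0 \<and> t n = 1 \<and> mono_on {..n} t}"

definition rectifiable :: "(real \<Rightarrow> 'a::metric_space) \<Rightarrow> bool" where
  "rectifiable \<gamma> \<longleftrightarrow> bdd_above (variation_sums \<gamma>)"

definition curve_length :: "(real \<Rightarrow> 'a::metric_space) \<Rightarrow> real" where
  "curve_length \<gamma> = Sup (variation_sums \<gamma>)"

definition c_quasiconvex :: "real \<Rightarrow> 'a::metric_space set \<Rightarrow> bool" where
  "c_quasiconvex c Z \<longleftrightarrow> c \<ge> 1 \<and> (\<forall>x\<in>Z. \<forall>y\<in>Z. \<exists>\<gamma>.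
      path \<gamma> \<and> path_image \<gamma> \<subseteq> Z \<and> pathstart \<gamma> = x \<and> pathfinish \<gamma> = y \<and>
      rectifiable \<gamma> \<and> curve_length \<gamma> \<le> c * dist x y)"

definition quasiconvex :: "'a::metric_space set \<Rightarrow> bool" where
  "quasiconvex Z \<longleftrightarrow> (\<exists>c. c_quasiconvex c Z)"

section \<open>Equivalent norms and smoothness\<close>

definition equivalent_norm :: "('a::real_normed_vector \<Rightarrow> real) \<Rightarrow> bool" where
  "equivalent_norm N \<longleftrightarrow>
     (\<forall>x. N x = 0 \<longleftrightarrow> x = 0) \<and>
     (\<forall>r x. N (r *\<^sub>R x) = \<bar>r\<bar> * N x) \<and>
     (\<forall>x y. N (x + y) \<le> N x + N y) \<and>
     (\<exists>a>0. \<exists>b>0. \<forall>x. a * norm x \<le> N x \<and> N x \<le> b * norm x)"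

text \<open>The element 0 is inserted only to make the modulus of the trivial space (where the supremum
  ranges over the empty set) equal to 0. Otherwise it has no effect, because
  \<open>N (x + \<tau> y) + N (x - \<tau> y) \<ge> 2 N x = 2\<close> by the triangle inequality.\<close>

definition modulus_of_smoothness :: "('a::real_vector \<Rightarrow> real) \<Rightarrow> real \<Rightarrow> real" where
  "modulus_of_smoothness N \<tau> =
     Sup (insert 0 {(N (x + \<tau> *\<^sub>R y) + N (x - \<tau> *\<^sub>R y)) / 2 - 1 | x y. N x = 1 \<and> N y = 1})"

definition smoothness_power_type :: "real \<Rightarrow> ('a::real_vector \<Rightarrow> real) \<Rightarrow> bool" where
  "smoothness_power_type p N \<longleftrightarrow>
     p > 1 \<and> (\<exists>K>0. \<forall>\<tau>\<ge>0. modulus_of_smoothness N \<tau> \<le> K * \<tau> powr p)"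

definition uniformly_smooth :: "('a::real_vector \<Rightarrow> real) \<Rightarrow> bool" where
  "uniformly_smooth N \<longleftrightarrow> ((\<lambda>\<tau>. modulus_of_smoothness N \<tau> / \<tau>) \<longlongrightarrow> 0) (at_right 0)"

text \<open>Super-reflexivity is expressed by Enflo's renorming criterion, since quantifying over all
  Banach spaces finitely representable in a given one is not possible in HOL.\<close>

definition super_reflexive :: "'a::banach itself \<Rightarrow> bool" where
  "super_reflexive _ \<longleftrightarrow> (\<exists>N :: 'a \<Rightarrow> real. equivalent_norm N \<and> uniformly_smooth N)"

end

theory Submission
  imports Defs
begin

text \<open>
  Write \<open>\<phi> = N\<^sup>1\<^sup>+\<^sup>\<alpha>\<close>. The smoothness of \<open>N\<close> says that the second differences
  \<open>\<phi> (x + v) + \<phi> (x - v) - 2 \<phi> x\<close> are at most a multiple of \<open>\<phi> v\<close>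
  (\<open>norm_powr_type_second_difference\<close>). Conversely, a locally bounded \<open>F\<close> whose second differences are
  \<open>O(|v|\<^sup>1\<^sup>+\<^sup>\<alpha>)\<close> from both sides is of class \<open>C\<^sup>1\<^sup>,\<^sup>\<alpha>\<close> on the whole space
  (\<open>C1_holder_of_second_difference\<close>). So the problem is to extend \<open>f\<close> with two-sided control of second
  differences, and no derivative of the extension has to be constructed by hand.

  Let \<open>p z\<close> be the tangent plane of \<open>f\<close> at \<open>z \<in> U\<close>, and consider the barriers
  \<open>p z x \<plusminus> M \<phi> (x - z)\<close>. The second differences of the upper barriers are at most a multiple of \<open>\<phi> v\<close>,
  those of the lower barriers at least minus that multiple. Because \<open>U\<close> is quasiconvex, Taylor's
  formula with remainder \<open>O(|y - z|\<^sup>1\<^sup>+\<^sup>\<alpha>)\<close> holds for \<open>y, z \<in> U\<close> (\<open>taylor_bound_on_quasiconvex\<close>), and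
  therefore, for large \<open>M\<close>, every lower barrier lies below every upper barrier
  (\<open>tangent_planes_gap\<close>).

  The sandwich lemma \<open>second_difference_sandwich\<close> then inserts between the two families a function
  \<open>F\<close> whose second differences are bounded on both sides: the largest function below the
  upper barriers that satisfies the lower bound on second differences. Since both barriers at \<open>z\<close> take
  the value \<open>f z\<close> at \<open>z\<close>, the function \<open>F\<close> agrees with \<open>f\<close> on \<open>U\<close>, and the barriers at a single
  point bound \<open>F\<close> locally.
\<close>

section \<open>Sandwiching with two-sided second difference bounds\<close>

definition second_difference :: "('a::ab_group_add \<Rightarrow> real) \<Rightarrow> 'a \<Rightarrow> 'a \<Rightarrow> real" where
  "second_difference F x v = F (x + v) + F (x - v) - 2 * F x"

text \<open>The solution is the largest function \<open>h \<le> Q\<close> whose second differences are bounded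
  below by \<open>- \<omega>\<close>, a substitute for the convex envelope. The lower bound survives suprema. The upper
  bound comes from maximality: averaging \<open>F\<close> over the translates by \<open>v\<close> and \<open>- v\<close> and then
  subtracting \<open>\<omega> v / 2\<close> gives another competitor, because averaging preserves the lower bound and
  the subtracted constant makes up for what the averages of the members of \<open>Q\<close> may gain. This
  competitor cannot exceed \<open>F\<close>, which is the upper bound for \<open>F\<close>.\<close>

lemma second_difference_sandwich:
  fixes L Q :: "('a::ab_group_add \<Rightarrow> real) set"
  assumes "L \<noteq> {}" "Q \<noteq> {}"
    and lower: "\<And>l x v. l \<in> L \<Longrightarrow> - \<omega> v \<le> second_difference l x v"
    and upper: "\<And>q x v. q \<in> Q \<Longrightarrow> second_difference q x v \<le> \<omega> v"
    and le: "\<And>l q x. l \<in> L \<Longrightarrow> q \<in> Q \<Longrightarrow> l x \<le> q x"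
  obtains F where "\<And>l x. l \<in> L \<Longrightarrow> l x \<le> F x" "\<And>q x. q \<in> Q \<Longrightarrow> F x \<le> q x"
    "\<And>x v. \<bar>second_difference F x v\<bar> \<le> \<omega> v"
proof -
  define S where "S = {h. (\<forall>x v. - \<omega> v \<le> second_difference h x v) \<and> (\<forall>q\<in>Q. \<forall>x. h x \<le> q x)}"
  define F where "F = (\<lambda>x. SUP h\<in>S. h x)"
  have L_S: "L \<subseteq> S"
    unfolding S_def using lower le by blast
  have bdd: "bdd_above ((\<lambda>h. h x) ` S)" for x
  proof -
    obtain q where "q \<in> Q" using \<open>Q \<noteq> {}\<close> by blast
    then show ?thesis by (intro bdd_aboveI[of _ "q x"]) (auto simp: S_def)
  qed
  have S_F: "h x \<le> F x" if "h \<in> S" for h x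
    unfolding F_def using that bdd by (rule cSUP_upper)
  have F_leI: "F x \<le> b" if "\<And>h. h \<in> S \<Longrightarrow> h x \<le> b" for x b
    unfolding F_def using that L_S \<open>L \<noteq> {}\<close> by (intro cSUP_least) auto
  have F_Q: "F x \<le> q x" if "q \<in> Q" for q x
    using that by (intro F_leI) (auto simp: S_def)
  have F_lower: "- \<omega> v \<le> second_difference F x v" for x v
  proof -
    have "F x \<le> (F (x + v) + F (x - v) + \<omega> v) / 2"
    proof (rule F_leI)
      fix h assume h: "h \<in> S"
      then have "- \<omega> v \<le> second_difference h x v" by (simp add: S_def)
      then show "h x \<le> (F (x + v) + F (x - v) + \<omega> v) / 2"
        using S_F[OF h, of "x + v"] S_F[OF h, of "x - v"]
        by (simp add: second_difference_def)
    qed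
    then show ?thesis by (simp add: second_difference_def)
  qed
  have F_upper: "second_difference F x v \<le> \<omega> v" for x v
  proof -
    \<comment> \<open>The competitor, to be compared with the maximal \<open>F\<close> at the point \<open>x\<close>.\<close>
    define H where "H = (\<lambda>z. (F (z + v) + F (z - v) - \<omega> v) / 2)"
    have "H \<in> S"
      unfolding S_def
    proof (intro CollectI conjI allI ballI)
      fix z w
      have "second_difference H z w
          = (second_difference F (z + v) w + second_difference F (z - v) w) / 2"
        by (simp add: second_difference_def H_def field_simps)
      then show "- \<omega> w \<le> second_difference H z w"
        using F_lower[of w "z + v"] F_lower[of w "z - v"] by simp
    next
      fix q z assume q: "q \<in> Q"
      show "H z \<le> q z"
        using F_Q[OF q, of "z + v"] F_Q[OF q, of "z - v"] upper[OF q, of z v]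
        by (simp add: H_def second_difference_def)
    qed
    from S_F[OF this, of x] show ?thesis by (simp add: H_def second_difference_def)
  qed
  show thesis
    using that[of F] L_S S_F F_Q F_lower F_upper by (metis abs_le_iff minus_le_iff subsetD)
qed

section \<open>Differentiability from second differences\<close>

text \<open>Homogeneity is the point. For fixed \<open>v\<close>, the function \<open>r \<mapsto> T (r v) - r T v\<close> is additive
  and has period 1, so it is bounded because \<open>T\<close> is bounded on the segment from 0 to \<open>v\<close>. A bounded
  additive function vanishes.\<close>

lemma additive_locally_bounded_imp_bounded_linear:
  fixes T :: "'a::real_normed_vector \<Rightarrow> real"
  assumes add: "\<And>u v. T (u + v) = T u + T v"
    and "\<delta> > 0" and bound: "\<And>v. norm v \<le> \<delta> \<Longrightarrow> \<bar>T v\<bar> \<le> B"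
  shows "bounded_linear T"
proof -
  have T0: "T 0 = 0" using add[of 0 0] by simp
  have T_minus: "T (- v) = - T v" for v using add[of v "- v"] T0 by simp
  have T_nat: "T (real n *\<^sub>R v) = real n * T v" for n v
    by (induction n) (simp_all add: T0 add algebra_simps)
  have T_int: "T (of_int k *\<^sub>R v) = of_int k * T v" for k v
  proof (cases k rule: int_cases2)
    case (nonneg n) then show ?thesis by (simp add: T_nat)
  next
    case (nonpos n) then show ?thesis by (simp add: T_nat T_minus)
  qed
  have T_scale: "T (r *\<^sub>R v) = r * T v" for r v
  proof -
    obtain m where m: "norm v / \<delta> < real m" using reals_Archimedean2 by blast
    have "0 \<le> norm v / \<delta>" using \<open>\<delta> > 0\<close> by simp
    with m have "m \<noteq> 0" by (metis not_less of_nat_0)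
    \<comment> \<open>The segment from 0 to \<open>v\<close> shrinks into the ball of radius \<open>\<delta>\<close> when divided by \<open>m\<close>.\<close>
    have T_unit: "\<bar>T (s *\<^sub>R v)\<bar> \<le> real m * B" if "0 \<le> s" "s \<le> 1" for s
    proof -
      have "s * norm v \<le> norm v" using that by (simp add: mult_left_le_one_le)
      also have "\<dots> \<le> \<delta> * real m"
        using m \<open>\<delta> > 0\<close> by (simp add: field_simps)
      finally have "norm ((s / real m) *\<^sub>R v) \<le> \<delta>"
        using \<open>m \<noteq> 0\<close> that by (simp add: field_simps)
      then have "\<bar>T ((s / real m) *\<^sub>R v)\<bar> \<le> B" by (rule bound)
      then show ?thesis
        using T_nat[of m "(s / real m) *\<^sub>R v"] \<open>m \<noteq> 0\<close> by (simp add: abs_mult mult_left_mono)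
    qed
    have "real n * \<bar>T (r *\<^sub>R v) - r * T v\<bar> \<le> real m * B + \<bar>T v\<bar>" for n
    proof -
      \<comment> \<open>Only the fractional part of \<open>n r\<close> contributes to the deviation from homogeneity.\<close>
      define k where "k = \<lfloor>real n * r\<rfloor>"
      define s where "s = real n * r - of_int k"
      have s: "0 \<le> s" "s \<le> 1" unfolding s_def k_def by linarith+
      have "real n * T (r *\<^sub>R v) = T (of_int k *\<^sub>R v + s *\<^sub>R v)"
        unfolding s_def by (simp add: T_nat[symmetric] algebra_simps)
      also have "\<dots> = of_int k * T v + T (s *\<^sub>R v)" by (simp add: add T_int)
      finally have "real n * (T (r *\<^sub>R v) - r * T v) = T (s *\<^sub>R v) - s * T v"
        by (simp add: s_def algebra_simps)
      moreover have "\<bar>s * T v\<bar> \<le> \<bar>T v\<bar>"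
        using s by (simp add: abs_mult mult_left_le_one_le)
      ultimately show ?thesis
        using T_unit[OF s] abs_mult[of "real n" "T (r *\<^sub>R v) - r * T v"] by simp
    qed
    then have "\<not> 0 < \<bar>T (r *\<^sub>R v) - r * T v\<bar>"
      using reals_Archimedean3[of "\<bar>T (r *\<^sub>R v) - r * T v\<bar>"] by (meson not_less)
    then show ?thesis by simp
  qed
  have "norm (T v) \<le> norm v * (B / \<delta>)" for v
  proof (cases "v = 0")
    case False
    have "\<bar>T ((\<delta> / norm v) *\<^sub>R v)\<bar> \<le> B" using False \<open>\<delta> > 0\<close> by (intro bound) simp
    then show ?thesis using False \<open>\<delta> > 0\<close> by (simp add: T_scale abs_mult field_simps)
  qed (simp add: T0)
  then show ?thesis
    by (intro bounded_linear_intro[where K = "B / \<delta>"]) (simp_all add: add T_scale)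
qed

text \<open>The derivative is the limit of the difference quotients \<open>D v n\<close> along the steps
  \<open>2\<^sup>-\<^sup>n v\<close>. By the second difference at the midpoint of two points near \<open>x\<close>, the quotients are
  additive up to an error decaying like \<open>2\<^sup>-\<^sup>n\<^sup>\<alpha>\<close>. The case \<open>v = 0\<close> of this estimate gives geometric
  convergence of \<open>D u n\<close> together with the distance of the limit from \<open>D u 0 = F (x + u) - F x\<close>,
  and the limit \<open>n \<rightarrow> \<infinity>\<close> makes \<open>T\<close> additive. Local boundedness of \<open>F\<close> excludes discontinuous additive
  functions, whose second differences all vanish.\<close>

lemma first_order_expansion_of_second_difference:
  fixes F :: "'a::real_normed_vector \<Rightarrow> real"
  assumes "0 < \<alpha>"
    and sd: "\<And>x v. \<bar>second_difference F x v\<bar> \<le> C * norm v powr (1 + \<alpha>)"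
    and "\<delta> > 0" and bound: "\<And>v. norm v \<le> \<delta> \<Longrightarrow> \<bar>F (x + v)\<bar> \<le> B"
  defines "K \<equiv> C / (1 - 2 powr (- \<alpha>))"
  obtains T where "bounded_linear T" "\<And>v. \<bar>F (x + v) - F x - T v\<bar> \<le> K * norm v powr (1 + \<alpha>)"
proof -
  define \<theta> :: real where "\<theta> = 2 powr (- \<alpha>)"
  have \<theta>: "0 < \<theta>" "\<theta> < 1" using \<open>0 < \<alpha>\<close> by (simp_all add: \<theta>_def powr_less_one)
  have small: "2 ^ n * norm ((1 / 2 ^ n) *\<^sub>R v) powr (1 + \<alpha>) = \<theta> ^ n * norm v powr (1 + \<alpha>)"
    for n and v :: 'a
  proof -
    have u: "1 / 2 ^ n = (2::real) powr (- real n)"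
      by (simp add: powr_minus powr_realpow divide_inverse)
    have "(2::real) ^ n * (1 / 2 ^ n) powr (1 + \<alpha>) = (1 / 2 ^ n) powr \<alpha>"
      by (simp add: powr_add)
    also have "\<dots> = \<theta> ^ n"
      unfolding u by (simp add: powr_powr \<theta>_def powr_power mult.commute)
    finally have "(2::real) ^ n * (1 / 2 ^ n) powr (1 + \<alpha>) = \<theta> ^ n" .
    moreover have "norm ((1 / 2 ^ n) *\<^sub>R v) powr (1 + \<alpha>)
        = (1 / 2 ^ n) powr (1 + \<alpha>) * norm v powr (1 + \<alpha>)"
      by (simp add: powr_mult powr_divide)
    ultimately show ?thesis by (metis mult.assoc)
  qed
  have C_nonneg: "0 \<le> C * norm v powr (1 + \<alpha>)" for v :: 'a using sd[of 0 v] by linarith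
  define D where "D = (\<lambda>v n. 2 ^ n * (F (x + (1 / 2 ^ n) *\<^sub>R v) - F x))"
  have step: "\<bar>D u n + D v n - D (u + v) (Suc n)\<bar> \<le> C * norm (u - v) powr (1 + \<alpha>) * \<theta> ^ n" for u v n
  proof -
    \<comment> \<open>The points \<open>x + u / 2\<^sup>n\<close> and \<open>x + v / 2\<^sup>n\<close> have midpoint \<open>a\<close> and lie symmetrically at \<open>a \<plusminus> w\<close>.\<close>
    define a where "a = x + (1 / 2 ^ Suc n) *\<^sub>R (u + v)"
    define w where "w = (1 / 2 ^ n) *\<^sub>R ((1 / 2) *\<^sub>R (u - v))"
    have half: "(1 / 2 ^ n) *\<^sub>R z = (1 / 2 ^ Suc n) *\<^sub>R z + (1 / 2 ^ Suc n) *\<^sub>R z" for z :: 'a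
      by (simp flip: scaleR_add_left)
    have eq: "x + (1 / 2 ^ n) *\<^sub>R u = a + w" "x + (1 / 2 ^ n) *\<^sub>R v = a - w"
      by (simp_all add: a_def w_def half algebra_simps)
    have "D u n + D v n - D (u + v) (Suc n) = 2 ^ n * second_difference F a w"
      unfolding D_def second_difference_def eq a_def[symmetric] by (simp add: algebra_simps)
    then have "\<bar>D u n + D v n - D (u + v) (Suc n)\<bar> = 2 ^ n * \<bar>second_difference F a w\<bar>"
      by (simp add: abs_mult)
    also have "\<dots> \<le> 2 ^ n * (C * norm w powr (1 + \<alpha>))"
      using sd by (intro mult_left_mono) auto
    also have "\<dots> = C * norm ((1 / 2) *\<^sub>R (u - v)) powr (1 + \<alpha>) * \<theta> ^ n"
      unfolding w_def using small[of n "(1 / 2) *\<^sub>R (u - v)"] by (simp add: mult.assoc mult.left_commute)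
    also have "\<dots> \<le> C * norm (u - v) powr (1 + \<alpha>) * \<theta> ^ n"
    proof -
      have "C * norm ((1 / 2) *\<^sub>R (u - v)) powr (1 + \<alpha>)
          = (1/2) powr (1 + \<alpha>) * (C * norm (u - v) powr (1 + \<alpha>))"
        using powr_mult[of "1/2" "norm (u - v)" "1 + \<alpha>"] by simp
      also have "\<dots> \<le> C * norm (u - v) powr (1 + \<alpha>)"
        using C_nonneg \<open>0 < \<alpha>\<close> by (intro mult_left_le_one_le) (auto intro: powr_le1)
      finally show ?thesis using \<theta> by (intro mult_right_mono) auto
    qed
    finally show ?thesis .
  qed
  have D_step: "\<bar>D v (Suc n) - D v n\<bar> \<le> C * norm v powr (1 + \<alpha>) * \<theta> ^ n" for v n
    using step[of v n 0] by (simp add: D_def)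
  have geo: "summable (\<lambda>n. C * norm v powr (1 + \<alpha>) * \<theta> ^ n)" for v :: 'a
    using \<theta> by (intro summable_mult summable_geometric) auto
  define T where "T = (\<lambda>v. D v 0 + (\<Sum>n. D v (Suc n) - D v n))"
  have D_T: "D v \<longlonglongrightarrow> T v" for v
  proof -
    have "summable (\<lambda>n. D v (Suc n) - D v n)"
      using D_step by (intro summable_comparison_test'[OF geo]) auto
    then have "(\<lambda>n. D v 0 + (\<Sum>i<n. D v (Suc i) - D v i)) \<longlonglongrightarrow> T v"
      unfolding T_def by (intro tendsto_intros summable_LIMSEQ)
    then show ?thesis by (simp add: sum_lessThan_telescope)
  qed
  have expansion: "\<bar>F (x + v) - F x - T v\<bar> \<le> K * norm v powr (1 + \<alpha>)" for v
  proof -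
    have "norm (\<Sum>n. D v (Suc n) - D v n) \<le> (\<Sum>n. C * norm v powr (1 + \<alpha>) * \<theta> ^ n)"
      using D_step by (intro norm_suminf_le geo) auto
    also have "\<dots> = C * norm v powr (1 + \<alpha>) * (1 / (1 - \<theta>))"
      using \<theta> by (simp add: suminf_mult suminf_geometric summable_geometric)
    also have "\<dots> = K * norm v powr (1 + \<alpha>)" by (simp add: K_def \<theta>_def)
    finally show ?thesis by (simp add: T_def D_def)
  qed
  have T_add: "T (u + v) = T u + T v" for u v
  proof -
    have "(\<lambda>n. C * norm (u - v) powr (1 + \<alpha>) * \<theta> ^ n) \<longlonglongrightarrow> 0"
      using summable_LIMSEQ_zero[OF geo] by blast
    then have "(\<lambda>n. D u n + D v n - D (u + v) (Suc n)) \<longlonglongrightarrow> 0"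
      by (rule Lim_null_comparison[rotated]) (use step in auto)
    moreover have "(\<lambda>n. D u n + D v n - D (u + v) (Suc n)) \<longlonglongrightarrow> T u + T v - T (u + v)"
      by (intro tendsto_intros D_T LIMSEQ_Suc)
    ultimately show ?thesis using LIMSEQ_unique by fastforce
  qed
  have "bounded_linear T"
  proof (rule additive_locally_bounded_imp_bounded_linear[OF T_add \<open>\<delta> > 0\<close>])
    fix v :: 'a assume v: "norm v \<le> \<delta>"
    have "K * norm v powr (1 + \<alpha>) \<le> \<bar>K\<bar> * \<delta> powr (1 + \<alpha>)"
      using v \<open>0 < \<alpha>\<close> by (intro mult_mono powr_mono2) auto
    then show "\<bar>T v\<bar> \<le> 2 * B + \<bar>K\<bar> * \<delta> powr (1 + \<alpha>)"
      using bound[OF v] bound[of 0] \<open>\<delta> > 0\<close> expansion[of v] by simp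
  qed
  then show thesis using expansion that by blast
qed

text \<open>The expansion error \<open>K |v|\<^sup>1\<^sup>+\<^sup>\<alpha>\<close> does not depend on the base point. To compare the derivatives at
  \<open>x\<close> and \<open>y\<close>, evaluate them on vectors \<open>w\<close> with \<open>|w| = |x - y|\<close>: expanding \<open>F (y + w)\<close> around both
  points, and \<open>F y\<close> around \<open>x\<close>, shows that they differ there by \<open>O(|x - y|\<^sup>1\<^sup>+\<^sup>\<alpha>)\<close>, and dividing by \<open>|w|\<close> leaves the Hoelder
  bound.\<close>

lemma C1_holder_of_second_difference:
  fixes F :: "'a::real_normed_vector \<Rightarrow> real"
  assumes "0 < \<alpha>"
    and sd: "\<And>x v. \<bar>second_difference F x v\<bar> \<le> C * norm v powr (1 + \<alpha>)"
    and bounded: "\<And>x. \<exists>\<delta>>0. \<exists>B. \<forall>v. norm v \<le> \<delta> \<longrightarrow> \<bar>F (x + v)\<bar> \<le> B"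
  shows "F \<in> C1_holder \<alpha> UNIV"
proof -
  define K where "K = \<bar>C / (1 - 2 powr (- \<alpha>))\<bar>"
  have "\<exists>T. bounded_linear T \<and> (\<forall>v. \<bar>F (x + v) - F x - T v\<bar> \<le> K * norm v powr (1 + \<alpha>))" for x
  proof -
    obtain \<delta> B where "\<delta> > 0" "\<And>v. norm v \<le> \<delta> \<Longrightarrow> \<bar>F (x + v)\<bar> \<le> B"
      using bounded[of x] by blast
    then obtain T where "bounded_linear T"
      and T: "\<And>v. \<bar>F (x + v) - F x - T v\<bar> \<le> C / (1 - 2 powr (- \<alpha>)) * norm v powr (1 + \<alpha>)"
      using first_order_expansion_of_second_difference[OF \<open>0 < \<alpha>\<close> sd] by metis
    have "\<bar>F (x + v) - F x - T v\<bar> \<le> K * norm v powr (1 + \<alpha>)" for v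
      unfolding K_def by (intro order_trans[OF T] mult_right_mono abs_ge_self) auto
    with \<open>bounded_linear T\<close> show ?thesis by blast
  qed
  then have "\<exists>L :: 'a \<Rightarrow>\<^sub>L real. \<forall>v. \<bar>F (x + v) - F x - L v\<bar> \<le> K * norm v powr (1 + \<alpha>)" for x
    by (metis bounded_linear_Blinfun_apply)
  then obtain F' :: "'a \<Rightarrow> 'a \<Rightarrow>\<^sub>L real"
    where F': "\<And>x v. \<bar>F (x + v) - F x - F' x v\<bar> \<le> K * norm v powr (1 + \<alpha>)"
    by metis
  have "K \<ge> 0" by (simp add: K_def)
  have deriv: "(F has_derivative F' x) (at x)" for x
    unfolding has_derivative_at
  proof
    have "((\<lambda>h::'a. K * norm h powr \<alpha>) \<longlongrightarrow> 0) (at 0)"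
      using \<open>0 < \<alpha>\<close> by (auto intro!: tendsto_eq_intros tendsto_zero_powrI)
    then show "(\<lambda>h. norm (F (x + h) - F x - F' x h) / norm h) \<midarrow>0\<rightarrow> 0"
    proof (rule Lim_null_comparison[rotated], intro always_eventually allI)
      fix h :: 'a
      have "\<bar>F (x + h) - F x - F' x h\<bar> \<le> K * norm h powr \<alpha> * norm h"
        using F'[of x h] by (cases "h = 0") (auto simp: powr_add algebra_simps)
      then show "norm (norm (F (x + h) - F x - F' x h) / norm h) \<le> K * norm h powr \<alpha>"
        using \<open>K \<ge> 0\<close> by (cases "h = 0") (auto simp: pos_divide_le_eq)
    qed
  qed (rule blinfun.bounded_linear_right)
  have hoelder: "norm (F' x - F' y) \<le> (2 + 2 powr (1 + \<alpha>)) * K * norm (x - y) powr \<alpha>" for x y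
  proof (cases "x = y")
    case False
    define h where "h = norm (x - y)"
    have "h > 0" using False by (simp add: h_def)
    show ?thesis
    proof (rule norm_blinfun_bound)
      fix v
      show "norm ((F' x - F' y) v) \<le> (2 + 2 powr (1 + \<alpha>)) * K * norm (x - y) powr \<alpha> * norm v"
      proof (cases "v = 0")
        case v: False
        define w where "w = (h / norm v) *\<^sub>R v"
        have w: "norm w = h" using v \<open>h > 0\<close> by (simp add: w_def)
        have "norm (y - x + w) \<le> 2 * h"
          using norm_triangle_ineq[of "y - x" w] w by (simp add: h_def norm_minus_commute)
        then have "K * norm (y - x + w) powr (1 + \<alpha>) \<le> K * (2 powr (1 + \<alpha>) * h powr (1 + \<alpha>))"
          using \<open>h > 0\<close> \<open>0 < \<alpha>\<close> \<open>K \<ge> 0\<close> powr_mono2[of "1 + \<alpha>" "norm (y - x + w)" "2 * h"]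
          by (intro mult_left_mono) (auto simp: powr_mult)
        with F'[of y w] F'[of x "y - x"] F'[of x "y - x + w"]
        have "\<bar>(F' x - F' y) w\<bar> \<le> (2 + 2 powr (1 + \<alpha>)) * K * h powr (1 + \<alpha>)"
          using w by (simp add: h_def norm_minus_commute blinfun.bilinear_simps algebra_simps)
        also have "\<dots> = (2 + 2 powr (1 + \<alpha>)) * K * h powr \<alpha> * h"
          using \<open>h > 0\<close> by (simp add: powr_add)
        finally have "h * \<bar>(F' x - F' y) v\<bar>
            \<le> h * ((2 + 2 powr (1 + \<alpha>)) * K * h powr \<alpha> * norm v)"
          using v \<open>h > 0\<close>
          by (simp add: w_def blinfun.scaleR_right abs_mult pos_divide_le_eq mult_ac)
        then show ?thesis using \<open>h > 0\<close> by (simp add: h_def)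
      qed simp
    qed (use \<open>K \<ge> 0\<close> in simp)
  qed simp
  \<comment> \<open>The constant in \<open>C1_holder\<close> has to be positive, while \<open>K\<close> may be 0.\<close>
  have "(2 + 2 powr (1 + \<alpha>)) * K * norm (x - y) powr \<alpha>
      \<le> ((2 + 2 powr (1 + \<alpha>)) * K + 1) * norm (x - y) powr \<alpha>" for x y :: 'a
    by (intro mult_right_mono) auto
  with hoelder have "\<forall>x y. norm (F' x - F' y) \<le> ((2 + 2 powr (1 + \<alpha>)) * K + 1) * norm (x - y) powr \<alpha>"
    using order_trans by blast
  moreover have "(2 + 2 powr (1 + \<alpha>)) * K + 1 > 0"
    using \<open>K \<ge> 0\<close> by (intro add_nonneg_pos) auto
  ultimately show ?thesis unfolding C1_holder_def using deriv by blast
qed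

section \<open>Powers of a norm with power type smoothness\<close>

text \<open>By homogeneity it suffices to treat \<open>N u = 1\<close>, \<open>\<tau> = N v\<close>. For \<open>\<tau> \<ge> 1\<close> all terms have order
  at most \<open>\<tau>\<^sup>1\<^sup>+\<^sup>\<alpha>\<close>. For \<open>\<tau> < 1\<close> both \<open>N (u \<plusminus> v)\<close> are within \<open>\<tau>\<close> of 1, and the power is expanded
  around 1: the sum of the linear terms is controlled by the modulus of smoothness, and the quadratic
  terms are at most \<open>\<tau>\<^sup>2 \<le> \<tau>\<^sup>1\<^sup>+\<^sup>\<alpha>\<close>.\<close>

lemma norm_powr_type_second_difference:
  fixes N :: "'a::real_normed_vector \<Rightarrow> real"
  assumes \<alpha>: "0 < \<alpha>" "\<alpha> \<le> 1" and N: "equivalent_norm N" and "smoothness_power_type (1 + \<alpha>) N"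
  obtains C where "C > 0"
    "\<And>x v. second_difference (\<lambda>z. N z powr (1 + \<alpha>)) x v \<le> C * N v powr (1 + \<alpha>)"
proof -
  define p where "p = 1 + \<alpha>"
  have N0: "N x = 0 \<longleftrightarrow> x = 0" and N_scale: "N (r *\<^sub>R x) = \<bar>r\<bar> * N x"
    and N_tri: "N (x + y) \<le> N x + N y" for x y r
    using N unfolding equivalent_norm_def by auto
  have N_minus: "N (- x) = N x" for x using N_scale[of "-1" x] by simp
  have N_nonneg: "0 \<le> N x" for x
    using N_tri[of x "- x"] N0[of 0] by (simp add: N_minus)
  obtain K where "K > 0" and K: "\<And>\<tau>. \<tau> \<ge> 0 \<Longrightarrow> modulus_of_smoothness N \<tau> \<le> K * \<tau> powr p"
    using assms(4) unfolding smoothness_power_type_def p_def by auto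
  \<comment> \<open>Bernoulli's inequality \<open>a\<^sup>\<alpha> \<le> 1 + \<alpha> (a - 1)\<close>, multiplied by \<open>a\<close>.\<close>
  have bernoulli: "a powr p \<le> 1 + p * (a - 1) + (a - 1)\<^sup>2" if "a \<ge> 0" for a
  proof (cases "a = 0")
    case True then show ?thesis using \<alpha> by (simp add: p_def)
  next
    case False
    have "a powr \<alpha> * 1 powr (1 - \<alpha>) \<le> \<alpha> * a + (1 - \<alpha>) * 1"
      using False that \<alpha> by (intro Youngs_inequality_0) auto
    then have "a * a powr \<alpha> \<le> a * (\<alpha> * a + (1 - \<alpha>))"
      using that by (intro mult_left_mono) auto
    also have "\<dots> = 1 + p * (a - 1) + \<alpha> * (a - 1)\<^sup>2"
      by (simp add: p_def power2_eq_square algebra_simps)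
    also have "\<dots> \<le> 1 + p * (a - 1) + (a - 1)\<^sup>2"
      using \<alpha> by (simp add: mult_left_le_one_le)
    finally show ?thesis using False that by (simp add: p_def powr_add)
  qed
  have unit: "N (u + v) powr p + N (u - v) powr p \<le> 2 + (8 + 4 * K) * N v powr p"
    if "N u = 1" for u v
  proof (cases "N v < 1 \<and> v \<noteq> 0")
    case True
    define \<tau> where "\<tau> = N v"
    have \<tau>: "0 < \<tau>" "\<tau> < 1" using True N_nonneg[of v] N0[of v] by (auto simp: \<tau>_def)
    define w where "w = (1 / \<tau>) *\<^sub>R v"
    have v: "v = \<tau> *\<^sub>R w" and w: "N w = 1"
      using \<tau> by (auto simp: w_def N_scale) (simp add: \<tau>_def)
    let ?S = "insert 0 {(N (x + \<tau> *\<^sub>R y) + N (x - \<tau> *\<^sub>R y)) / 2 - 1 | x y. N x = 1 \<and> N y = 1}"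
    have est: "N (x + \<tau> *\<^sub>R y) \<le> 1 + \<tau>" "N (x - \<tau> *\<^sub>R y) \<le> 1 + \<tau>"
      if "N x = 1" "N y = 1" for x y
      using N_tri[of x "\<tau> *\<^sub>R y"] N_tri[of x "- (\<tau> *\<^sub>R y)"] that \<tau> by (auto simp: N_minus N_scale)
    have "(N (x + \<tau> *\<^sub>R y) + N (x - \<tau> *\<^sub>R y)) / 2 - 1 \<le> \<tau>" if "N x = 1" "N y = 1" for x y
      using est[OF that] by (simp add: field_simps)
    then have "bdd_above ?S"
      using \<tau> by (intro bdd_aboveI[of _ \<tau>]) auto
    then have "(N (u + v) + N (u - v)) / 2 - 1 \<le> modulus_of_smoothness N \<tau>"
      unfolding modulus_of_smoothness_def using that w v by (intro cSup_upper) auto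
    also have "\<dots> \<le> K * \<tau> powr p" using K \<tau> by simp
    finally have sum: "N (u + v) + N (u - v) \<le> 2 + 2 * K * \<tau> powr p" by (simp add: field_simps)
    have upper: "N (u + v) \<le> 1 + \<tau>" "N (u - v) \<le> 1 + \<tau>"
      using est[OF that w] by (simp_all add: v)
    have lower: "1 - \<tau> \<le> N (u + v)" "1 - \<tau> \<le> N (u - v)"
      using N_tri[of "u + v" "- v"] N_tri[of "u - v" v] that by (auto simp: N_minus \<tau>_def)
    have sq: "(N (u + v) - 1)\<^sup>2 \<le> \<tau> powr p" "(N (u - v) - 1)\<^sup>2 \<le> \<tau> powr p"
    proof -
      have "\<tau>\<^sup>2 = \<tau> powr 2" using \<tau> by (simp add: powr_numeral)
      also have "\<dots> \<le> \<tau> powr p" using \<tau> \<alpha> by (intro powr_mono') (auto simp: p_def)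
      finally have *: "\<tau>\<^sup>2 \<le> \<tau> powr p" .
      have "\<bar>N (u + v) - 1\<bar> \<le> \<tau>" "\<bar>N (u - v) - 1\<bar> \<le> \<tau>" using upper lower by auto
      then have "(N (u + v) - 1)\<^sup>2 \<le> \<tau>\<^sup>2" "(N (u - v) - 1)\<^sup>2 \<le> \<tau>\<^sup>2"
        using \<tau> by (metis abs_le_square_iff abs_of_pos)+
      with * show "(N (u + v) - 1)\<^sup>2 \<le> \<tau> powr p" "(N (u - v) - 1)\<^sup>2 \<le> \<tau> powr p" by auto
    qed
    have "p * (N (u + v) + N (u - v) - 2) \<le> 2 * (2 * K * \<tau> powr p)"
    proof -
      have "p * (N (u + v) + N (u - v) - 2) \<le> p * (2 * K * \<tau> powr p)"
        using sum \<alpha> by (intro mult_left_mono) (auto simp: p_def)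
      also have "\<dots> \<le> 2 * (2 * K * \<tau> powr p)"
        using \<alpha> \<open>K > 0\<close> by (intro mult_right_mono) (auto simp: p_def)
      finally show ?thesis .
    qed
    with bernoulli[OF N_nonneg, of "u + v"] bernoulli[OF N_nonneg, of "u - v"] sq
    have "N (u + v) powr p + N (u - v) powr p \<le> 2 + (2 + 4 * K) * \<tau> powr p"
      by (simp add: algebra_simps)
    also have "\<dots> \<le> 2 + (8 + 4 * K) * \<tau> powr p"
      by (intro add_left_mono mult_right_mono) auto
    finally show ?thesis by (simp add: \<tau>_def)
  next
    case False
    show ?thesis
    proof (cases "v = 0")
      case True then show ?thesis using that N0[of 0] by simp
    next
      case nz: False
      with False have v1: "N v \<ge> 1" by auto
      have *: "N z powr p \<le> 4 * N v powr p" if "N z \<le> 1 + N v" for z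
      proof -
        have "N z powr p \<le> (2 * N v) powr p"
          using that v1 \<alpha> N_nonneg by (intro powr_mono2) (auto simp: p_def)
        also have "\<dots> = 2 powr p * N v powr p" using v1 by (simp add: powr_mult)
        also have "\<dots> \<le> 2 powr 2 * N v powr p"
          using \<alpha> by (intro mult_right_mono powr_mono) (auto simp: p_def)
        finally show ?thesis by simp
      qed
      have "N (u + v) \<le> 1 + N v" "N (u - v) \<le> 1 + N v"
        using N_tri[of u v] N_tri[of u "- v"] that by (auto simp: N_minus)
      from this[THEN *] show ?thesis using \<open>K > 0\<close>
        by (simp add: algebra_simps) (smt (verit) mult_nonneg_nonneg powr_ge_zero)
    qed
  qed
  have "second_difference (\<lambda>z. N z powr p) x v \<le> (8 + 4 * K) * N v powr p" for x v
  proof (cases "x = 0")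
    case True
    have "0 \<le> (6 + 4 * K) * N v powr p" using \<open>K > 0\<close> by simp
    then show ?thesis using True N0[of 0] by (simp add: second_difference_def N_minus algebra_simps)
  next
    case False
    define r where "r = N x"
    have r: "r > 0" using False N_nonneg[of x] N0[of x] unfolding r_def by linarith
    define u w where "u = (1 / r) *\<^sub>R x" and "w = (1 / r) *\<^sub>R v"
    have x: "x = r *\<^sub>R u" and v: "v = r *\<^sub>R w" using r by (auto simp: u_def w_def)
    have u: "N u = 1" using r by (simp add: u_def N_scale r_def)
    have scale: "N (r *\<^sub>R z) powr p = r powr p * N z powr p" for z
      using r N_nonneg by (simp add: N_scale powr_mult)
    have "second_difference (\<lambda>z. N z powr p) x v
        = r powr p * (N (u + w) powr p + N (u - w) powr p - 2)"
      unfolding second_difference_def x v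
      by (simp add: scale u algebra_simps flip: scaleR_add_right scaleR_diff_right)
    also have "\<dots> \<le> r powr p * ((8 + 4 * K) * N w powr p)"
      using unit[OF u, of w] by (intro mult_left_mono) auto
    also have "\<dots> = (8 + 4 * K) * N v powr p" by (simp add: v scale)
    finally show ?thesis .
  qed
  moreover have "8 + 4 * K > 0" using \<open>K > 0\<close> by simp
  ultimately show thesis using that unfolding p_def by blast
qed

section \<open>Taylor estimates on quasiconvex sets\<close>

lemma variation_sum_le_curve_length:
  assumes "rectifiable \<gamma>" "t 0 = 0" "t n = 1" "mono_on {..n} t"
  shows "(\<Sum>i<n. dist (\<gamma> (t i)) (\<gamma> (t (Suc i)))) \<le> curve_length \<gamma>"
  unfolding curve_length_def
  by (rule cSup_upper) (use assms in \<open>auto simp: rectifiable_def variation_sums_def\<close>)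

lemma dist_start_le_curve_length:
  assumes "rectifiable \<gamma>" "0 \<le> s" "s \<le> 1"
  shows "dist (\<gamma> 0) (\<gamma> s) \<le> curve_length \<gamma>"
proof -
  define t where "t = (\<lambda>i::nat. if i = 0 then 0 else if i = 1 then s else 1)"
  have "(\<Sum>i<2. dist (\<gamma> (t i)) (\<gamma> (t (Suc i)))) \<le> curve_length \<gamma>"
    using assms by (intro variation_sum_le_curve_length) (auto simp: t_def mono_on_def)
  then have "dist (\<gamma> 0) (\<gamma> s) + dist (\<gamma> s) (\<gamma> 1) \<le> curve_length \<gamma>"
    by (simp add: t_def numeral_2_eq_2)
  with zero_le_dist[of "\<gamma> s" "\<gamma> 1"] show ?thesis by linarith
qed

text \<open>Subtracting the derivative at \<open>x\<close> leaves a function \<open>h\<close> with small derivative near the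
  curve. A fine subdivision makes consecutive points lie in a common ball inside \<open>U\<close>, so that the mean
  value inequality applies to each step even though \<open>U\<close> itself need not be convex, and the sum of the steps
  is at most the length of the curve.\<close>

lemma taylor_bound_along_curve:
  fixes f :: "'a::real_normed_vector \<Rightarrow> real" and f' :: "'a \<Rightarrow> 'a \<Rightarrow>\<^sub>L real"
  assumes "0 < \<alpha>" "0 \<le> C" "open U"
    and deriv: "\<And>z. z \<in> U \<Longrightarrow> (f has_derivative f' z) (at z)"
    and hoelder: "\<And>z. z \<in> U \<Longrightarrow> norm (f' z - f' x) \<le> C * norm (z - x) powr \<alpha>"
    and \<gamma>: "path \<gamma>" "path_image \<gamma> \<subseteq> U" "pathstart \<gamma> = x" "pathfinish \<gamma> = y"
    and len: "rectifiable \<gamma>" "curve_length \<gamma> \<le> R" and "R > 0"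
  shows "\<bar>f y - f x - f' x (y - x)\<bar> \<le> C * (2 * R) powr \<alpha> * R"
proof -
  define B where "B = C * (2 * R) powr \<alpha>"
  have "B \<ge> 0" using \<open>0 \<le> C\<close> by (simp add: B_def)
  define h where "h = (\<lambda>z. f z - f' x z)"
  obtain \<epsilon> where "\<epsilon> > 0" and \<epsilon>: "(\<Union>z\<in>path_image \<gamma>. ball z \<epsilon>) \<subseteq> U"
    using compact_subset_open_imp_ball_epsilon_subset[OF compact_path_image[OF \<gamma>(1)] \<open>open U\<close> \<gamma>(2)] .
  \<comment> \<open>Radius at most \<open>R\<close> keeps the balls around the curve within distance \<open>2 R\<close> of \<open>x\<close>.\<close>
  define r where "r = min \<epsilon> R"
  have "r > 0" using \<open>\<epsilon> > 0\<close> \<open>R > 0\<close> by (simp add: r_def)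
  have start: "\<gamma> 0 = x" "\<gamma> 1 = y" using \<gamma> by (simp_all add: pathstart_def pathfinish_def)
  have near: "\<bar>h (\<gamma> s) - h (\<gamma> t)\<bar> \<le> B * dist (\<gamma> s) (\<gamma> t)"
    if s: "0 \<le> s" "s \<le> 1" and t: "dist (\<gamma> s) (\<gamma> t) < r" for s t
  proof -
    have ball: "z \<in> U \<and> norm (z - x) \<le> 2 * R" if "z \<in> ball (\<gamma> s) r" for z
    proof
      have "\<gamma> s \<in> path_image \<gamma>" using s by (simp add: path_image_def)
      then show "z \<in> U" using that \<epsilon> by (force simp: r_def)
      have "dist z x \<le> dist (\<gamma> s) z + dist (\<gamma> 0) (\<gamma> s)"
        using dist_triangle[of z x "\<gamma> s"] by (simp add: start dist_commute)
      then show "norm (z - x) \<le> 2 * R"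
        using that dist_start_le_curve_length[OF len(1) s] len(2)
        by (simp add: r_def dist_norm)
    qed
    have "norm (h (\<gamma> s) - h (\<gamma> t)) \<le> B * norm (\<gamma> s - \<gamma> t)"
    proof (rule differentiable_bound)
      fix z assume z: "z \<in> ball (\<gamma> s) r"
      have "(h has_derivative (\<lambda>v. f' z v - f' x v)) (at z)"
        unfolding h_def using ball[OF z]
        by (intro has_derivative_diff deriv
            bounded_linear_imp_has_derivative[OF blinfun.bounded_linear_right]) auto
      then show "(h has_derivative blinfun_apply (f' z - f' x)) (at z within ball (\<gamma> s) r)"
        unfolding minus_blinfun.rep_eq by (rule has_derivative_at_withinI)
      have "norm (f' z - f' x) \<le> B"
        unfolding B_def using ball[OF z] \<open>0 \<le> C\<close> \<open>0 < \<alpha>\<close>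
        by (intro order_trans[OF hoelder] mult_left_mono powr_mono2) auto
      then show "onorm (blinfun_apply (f' z - f' x)) \<le> B" by (simp add: norm_blinfun.rep_eq)
    qed (use \<open>r > 0\<close> t in auto)
    then show ?thesis by (simp add: dist_norm)
  qed
  have "uniformly_continuous_on {0..1} \<gamma>"
    using \<gamma>(1) by (simp add: path_def compact_uniformly_continuous)
  then obtain \<delta> where "\<delta> > 0"
    and \<delta>: "\<And>s t. s \<in> {0..1} \<Longrightarrow> t \<in> {0..1} \<Longrightarrow> dist s t < \<delta> \<Longrightarrow> dist (\<gamma> s) (\<gamma> t) < r"
    using \<open>r > 0\<close> unfolding uniformly_continuous_on_def by metis
  obtain n :: nat where n: "n \<noteq> 0" "1 / real n < \<delta>"
    using \<open>\<delta> > 0\<close> by (metis real_arch_inverse inverse_eq_divide)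
  define t where "t = (\<lambda>i. real i / real n)"
  have "\<bar>h (\<gamma> (t (Suc i))) - h (\<gamma> (t i))\<bar> \<le> B * dist (\<gamma> (t i)) (\<gamma> (t (Suc i)))" if "i < n" for i
  proof -
    have "t i \<in> {0..1}" "t (Suc i) \<in> {0..1}" using that by (auto simp: t_def)
    moreover have "dist (t i) (t (Suc i)) < \<delta>"
      using n by (simp add: t_def dist_real_def add_divide_distrib)
    ultimately show ?thesis using near[of "t i" "t (Suc i)"] \<delta> by (auto simp: abs_minus_commute)
  qed
  then have "\<bar>\<Sum>i<n. h (\<gamma> (t (Suc i))) - h (\<gamma> (t i))\<bar> \<le> (\<Sum>i<n. B * dist (\<gamma> (t i)) (\<gamma> (t (Suc i))))"
    by (intro order_trans[OF sum_abs] sum_mono) auto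
  also have "(\<Sum>i<n. h (\<gamma> (t (Suc i))) - h (\<gamma> (t i))) = h y - h x"
    unfolding sum_lessThan_telescope[of "\<lambda>i. h (\<gamma> (t i))"] using n by (simp add: t_def start)
  also have "(\<Sum>i<n. B * dist (\<gamma> (t i)) (\<gamma> (t (Suc i)))) \<le> B * R"
    unfolding sum_distrib_left[symmetric]
    using variation_sum_le_curve_length[OF len(1), of t n] len(2) n \<open>B \<ge> 0\<close>
    by (intro mult_left_mono) (auto simp: t_def mono_on_def divide_right_mono)
  finally show ?thesis by (simp add: h_def B_def blinfun.diff_right algebra_simps)
qed

lemma taylor_bound_on_quasiconvex:
  fixes f :: "'a::real_normed_vector \<Rightarrow> real" and f' :: "'a \<Rightarrow> 'a \<Rightarrow>\<^sub>L real"
  assumes "0 < \<alpha>" "0 \<le> C" "open U" "c_quasiconvex c U"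
    and deriv: "\<And>z. z \<in> U \<Longrightarrow> (f has_derivative f' z) (at z)"
    and hoelder: "\<And>x y. x \<in> U \<Longrightarrow> y \<in> U \<Longrightarrow> norm (f' x - f' y) \<le> C * norm (x - y) powr \<alpha>"
    and "x \<in> U" "y \<in> U"
  shows "\<bar>f y - f x - f' x (y - x)\<bar> \<le> C * (2 * c) powr \<alpha> * c * norm (y - x) powr (1 + \<alpha>)"
proof (cases "x = y")
  case False
  have "c \<ge> 1" using assms(4) by (simp add: c_quasiconvex_def)
  obtain \<gamma> where \<gamma>: "path \<gamma>" "path_image \<gamma> \<subseteq> U" "pathstart \<gamma> = x" "pathfinish \<gamma> = y"
    "rectifiable \<gamma>" "curve_length \<gamma> \<le> c * dist x y"
    using assms unfolding c_quasiconvex_def by metis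
  have "\<bar>f y - f x - f' x (y - x)\<bar> \<le> C * (2 * (c * dist x y)) powr \<alpha> * (c * dist x y)"
    using assms False \<open>c \<ge> 1\<close> by (intro taylor_bound_along_curve[OF _ _ _ _ _ \<gamma>]) auto
  also have "\<dots> = C * (2 * c) powr \<alpha> * c * norm (y - x) powr (1 + \<alpha>)"
    using \<open>c \<ge> 1\<close> False powr_mult[of "2 * c" "dist x y" \<alpha>]
    by (simp add: dist_norm norm_minus_commute powr_add mult_ac)
  finally show ?thesis .
qed simp

text \<open>The compatibility of the first-order data of \<open>f\<close> at two points, observed from a third
  point \<open>x\<close>: since \<open>|y - z| \<le> 2 t\<close> for the larger distance \<open>t\<close> from \<open>x\<close>, the Taylor error contributes
  \<open>2\<^sup>1\<^sup>+\<^sup>\<alpha> \<le> 4\<close> and the change of the derivative \<open>2\<^sup>\<alpha> \<le> 2\<close> to the constant 6. The right-hand side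
  separates into a term for \<open>y\<close> and a term for \<open>z\<close>, as needed to compare the barriers at
  \<open>y\<close> and at \<open>z\<close>.\<close>

lemma tangent_planes_gap:
  fixes f :: "'a::real_normed_vector \<Rightarrow> real" and f' :: "'a \<Rightarrow> 'a \<Rightarrow>\<^sub>L real"
  assumes "0 < \<alpha>" "\<alpha> \<le> 1" "0 \<le> A"
    and taylor: "\<bar>f y - f z - f' z (y - z)\<bar> \<le> A * norm (y - z) powr (1 + \<alpha>)"
    and hoelder: "norm (f' z - f' y) \<le> A * norm (y - z) powr \<alpha>"
  shows "(f z + f' z (x - z)) - (f y + f' y (x - y))
    \<le> 6 * A * (norm (x - y) powr (1 + \<alpha>) + norm (x - z) powr (1 + \<alpha>))"
proof -
  define t where "t = max (norm (x - y)) (norm (x - z))"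
  have "t \<ge> 0" by (simp add: t_def le_max_iff_disj)
  have "norm (y - z) \<le> 2 * t"
    using norm_triangle_ineq4[of "x - z" "x - y"] by (simp add: t_def)
  then have yz: "norm (y - z) powr q \<le> 2 powr q * t powr q" if "q \<ge> 0" for q
    using powr_mono2[of q "norm (y - z)" "2 * t"] that \<open>t \<ge> 0\<close> by (simp add: powr_mult)
  have two: "(2::real) powr (1 + \<alpha>) \<le> 4" "(2::real) powr \<alpha> \<le> 2"
    using \<open>\<alpha> \<le> 1\<close> powr_mono[of "1 + \<alpha>" 2 "2::real"] powr_mono[of \<alpha> 1 "2::real"] by auto
  have "norm (y - z) powr (1 + \<alpha>) \<le> 4 * t powr (1 + \<alpha>)"
    using \<open>0 < \<alpha>\<close> two(1) by (intro order_trans[OF yz] mult_right_mono) auto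
  with taylor have first: "\<bar>f y - f z - f' z (y - z)\<bar> \<le> A * (4 * t powr (1 + \<alpha>))"
    using \<open>0 \<le> A\<close> by (elim order_trans) (rule mult_left_mono)
  have "norm (y - z) powr \<alpha> \<le> 2 * t powr \<alpha>"
    using \<open>0 < \<alpha>\<close> two(2) by (intro order_trans[OF yz] mult_right_mono) auto
  with hoelder have "norm (f' z - f' y) \<le> A * (2 * t powr \<alpha>)"
    using \<open>0 \<le> A\<close> by (elim order_trans) (rule mult_left_mono)
  moreover have "norm (x - y) \<le> t" by (simp add: t_def)
  ultimately have "norm (f' z - f' y) * norm (x - y) \<le> A * (2 * t powr \<alpha>) * t"
    using \<open>0 \<le> A\<close> by (intro mult_mono) auto
  with norm_blinfun[of "f' z - f' y" "x - y"]
  have "\<bar>(f' z - f' y) (x - y)\<bar> \<le> A * (2 * t powr \<alpha>) * t" by simp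
  also have "\<dots> = A * (2 * t powr (1 + \<alpha>))"
    using \<open>t \<ge> 0\<close> by (cases "t = 0") (auto simp: powr_add)
  finally have second: "\<bar>(f' z - f' y) (x - y)\<bar> \<le> A * (2 * t powr (1 + \<alpha>))" .
  have "(f z + f' z (x - z)) - (f y + f' y (x - y))
      = (f' z - f' y) (x - y) - (f y - f z - f' z (y - z))"
    by (simp add: blinfun.bilinear_simps)
  also have "\<dots> \<le> 6 * A * t powr (1 + \<alpha>)" using first second by (simp add: abs_le_iff)
  also have "\<dots> \<le> 6 * A * (norm (x - y) powr (1 + \<alpha>) + norm (x - z) powr (1 + \<alpha>))"
    using \<open>0 \<le> A\<close> by (intro mult_left_mono) (auto simp: t_def max_def)
  finally show ?thesis .
qed

section \<open>The extension theorem\<close>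

theorem corollary48:
  fixes \<alpha> :: real and U :: "'a::banach set" and f :: "'a \<Rightarrow> real"
  assumes "0 < \<alpha>" and "\<alpha> \<le> 1"
    and "super_reflexive TYPE('a)"
    and "\<exists>N :: 'a \<Rightarrow> real. equivalent_norm N \<and> smoothness_power_type (1 + \<alpha>) N"
    and "open U" and "quasiconvex U"
    and "f \<in> C1_holder \<alpha> U"
  shows "\<exists>F. F \<in> C1_holder \<alpha> UNIV \<and> (\<forall>x\<in>U. F x = f x)"
proof (cases "U = {}")
  case True
  have "(\<lambda>x::'a. 0) \<in> C1_holder \<alpha> UNIV"
    using \<open>0 < \<alpha>\<close> by (rule C1_holder_of_second_difference[where C = 0])
      (auto simp: second_difference_def intro: exI[of _ 1])
  then show ?thesis using True by blast
next
  case False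
  obtain N :: "'a \<Rightarrow> real" where N: "equivalent_norm N" "smoothness_power_type (1 + \<alpha>) N"
    using assms(4) by blast
  define \<phi> where "\<phi> = (\<lambda>v. N v powr (1 + \<alpha>))"
  obtain C\<^sub>0 where "C\<^sub>0 > 0" and \<phi>_sd: "\<And>x v. second_difference \<phi> x v \<le> C\<^sub>0 * \<phi> v"
    using norm_powr_type_second_difference[OF \<open>0 < \<alpha>\<close> \<open>\<alpha> \<le> 1\<close> N] unfolding \<phi>_def by blast
  have "\<phi> 0 = 0" using N by (simp add: \<phi>_def equivalent_norm_def)
  obtain a b where "a > 0" "b > 0" and \<phi>_lower: "\<And>v. a * norm v powr (1 + \<alpha>) \<le> \<phi> v"
    and \<phi>_upper: "\<And>v. \<phi> v \<le> b * norm v powr (1 + \<alpha>)"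
  proof -
    obtain a b where ab: "a > 0" "b > 0" "\<And>v. a * norm v \<le> N v" "\<And>v. N v \<le> b * norm v"
      using N(1) unfolding equivalent_norm_def by metis
    have "a powr (1 + \<alpha>) * norm v powr (1 + \<alpha>) \<le> \<phi> v" for v
      unfolding \<phi>_def powr_mult[symmetric]
      using ab \<open>0 < \<alpha>\<close> by (intro powr_mono2) auto
    moreover have "\<phi> v \<le> b powr (1 + \<alpha>) * norm v powr (1 + \<alpha>)" for v
    proof -
      have "0 \<le> N v" using ab(1) ab(3)[of v] by (meson less_imp_le mult_nonneg_nonneg norm_ge_zero order_trans)
      then show ?thesis
        unfolding \<phi>_def powr_mult[symmetric] using ab \<open>0 < \<alpha>\<close> by (intro powr_mono2) auto
    qed
    ultimately show thesis using that[of "a powr (1 + \<alpha>)" "b powr (1 + \<alpha>)"] ab by simp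
  qed
  obtain f' C where "C > 0"
    and deriv: "\<And>x. x \<in> U \<Longrightarrow> (f has_derivative blinfun_apply (f' x)) (at x)"
    and hoelder: "\<And>x y. x \<in> U \<Longrightarrow> y \<in> U \<Longrightarrow> norm (f' x - f' y) \<le> C * norm (x - y) powr \<alpha>"
    using assms(7) unfolding C1_holder_def by blast
  obtain c where c: "c_quasiconvex c U" using \<open>quasiconvex U\<close> unfolding quasiconvex_def by blast
  then have "c \<ge> 1" by (simp add: c_quasiconvex_def)
  define A where "A = C * (2 * c) powr \<alpha> * c"
  \<comment> \<open>So \<open>A\<close> serves both as the Taylor constant and as the Hoelder constant of \<open>f'\<close>.\<close>
  have "A \<ge> C"
  proof -
    have "1 * 1 \<le> (2 * c) powr \<alpha> * c"
      using \<open>c \<ge> 1\<close> \<open>0 < \<alpha>\<close> by (intro mult_mono ge_one_powr_ge_zero) auto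
    then show ?thesis using \<open>C > 0\<close> by (simp add: A_def mult.assoc)
  qed
  then have "A > 0" using \<open>C > 0\<close> by simp
  \<comment> \<open>\<open>M\<close> is chosen such that \<open>M \<phi>\<close> absorbs the gap between tangent planes.\<close>
  define M where "M = 6 * A / a"
  have "M > 0" using \<open>A > 0\<close> \<open>a > 0\<close> by (simp add: M_def)
  define p where "p = (\<lambda>z x. f z + f' z (x - z))"
  have gap: "p z x - M * \<phi> (x - z) \<le> p y x + M * \<phi> (x - y)" if "y \<in> U" "z \<in> U" for x y z
  proof -
    have "norm (f' z - f' y) \<le> A * norm (y - z) powr \<alpha>"
      using hoelder[OF that(2,1)] \<open>A \<ge> C\<close>
      by (smt (verit) mult_right_mono norm_minus_commute powr_ge_zero)
    moreover have "\<bar>f y - f z - f' z (y - z)\<bar> \<le> A * norm (y - z) powr (1 + \<alpha>)"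
      unfolding A_def using \<open>C > 0\<close> \<open>0 < \<alpha>\<close> that
      by (intro taylor_bound_on_quasiconvex[OF _ _ \<open>open U\<close> c deriv hoelder]) auto
    ultimately have "p z x - p y x
        \<le> 6 * A * (norm (x - y) powr (1 + \<alpha>) + norm (x - z) powr (1 + \<alpha>))"
      unfolding p_def using \<open>0 < \<alpha>\<close> \<open>\<alpha> \<le> 1\<close> \<open>A > 0\<close> by (intro tangent_planes_gap) auto
    also have "\<dots> = M * (a * norm (x - y) powr (1 + \<alpha>) + a * norm (x - z) powr (1 + \<alpha>))"
      using \<open>a > 0\<close> by (simp add: M_def field_simps)
    also have "\<dots> \<le> M * (\<phi> (x - y) + \<phi> (x - z))"
      using \<phi>_lower \<open>M > 0\<close> by (intro mult_left_mono add_mono) auto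
    finally show ?thesis by (simp add: algebra_simps)
  qed
  \<comment> \<open>The barriers at \<open>z\<close> both take the value \<open>f z\<close> at \<open>z\<close>, which forces \<open>F z = f z\<close>.\<close>
  define L where "L = (\<lambda>z x. p z x - M * \<phi> (x - z)) ` U"
  define Q where "Q = (\<lambda>z x. p z x + M * \<phi> (x - z)) ` U"
  have sd_eq: "second_difference (\<lambda>x. p z x + k * \<phi> (x - z)) x v = k * second_difference \<phi> (x - z) v" for z k x v
    by (simp add: second_difference_def p_def blinfun.bilinear_simps algebra_simps)
  obtain F where F_lower: "\<And>l x. l \<in> L \<Longrightarrow> l x \<le> F x" and F_upper: "\<And>q x. q \<in> Q \<Longrightarrow> F x \<le> q x"
    and F_sd: "\<And>x v. \<bar>second_difference F x v\<bar> \<le> M * (C\<^sub>0 * \<phi> v)"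
  proof (rule second_difference_sandwich)
    show "L \<noteq> {}" "Q \<noteq> {}" using False by (auto simp: L_def Q_def)
    show "- (M * (C\<^sub>0 * \<phi> v)) \<le> second_difference l x v" if "l \<in> L" for l x v
      using that sd_eq[of _ "- M"] \<phi>_sd \<open>M > 0\<close> by (auto simp: L_def)
    show "second_difference q x v \<le> M * (C\<^sub>0 * \<phi> v)" if "q \<in> Q" for q x v
      using that sd_eq[of _ M] \<phi>_sd \<open>M > 0\<close> by (auto simp: Q_def)
    show "l x \<le> q x" if "l \<in> L" "q \<in> Q" for l q x
      using that gap by (auto simp: L_def Q_def)
  qed blast
  have F_between: "p z x - M * \<phi> (x - z) \<le> F x" "F x \<le> p z x + M * \<phi> (x - z)" if "z \<in> U" for z x
    using that F_lower[of "\<lambda>x. p z x - M * \<phi> (x - z)" x] F_upper[of "\<lambda>x. p z x + M * \<phi> (x - z)" x]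
    by (auto simp: L_def Q_def)
  have "F x = f x" if "x \<in> U" for x
    using F_between[OF that, of x] by (simp add: \<open>\<phi> 0 = 0\<close> p_def)
  moreover have "F \<in> C1_holder \<alpha> UNIV"
  proof (rule C1_holder_of_second_difference[OF \<open>0 < \<alpha>\<close>])
    fix x v
    show "\<bar>second_difference F x v\<bar> \<le> M * C\<^sub>0 * b * norm v powr (1 + \<alpha>)"
      using F_sd[of x v] \<phi>_upper[of v] \<open>M > 0\<close> \<open>C\<^sub>0 > 0\<close>
      by (smt (verit) mult.assoc mult_left_mono mult_pos_pos)
  next
    fix x
    obtain z where "z \<in> U" using False by blast
    define s where "s = norm (x - z) + 1"
    have "\<bar>F (x + v)\<bar> \<le> \<bar>f z\<bar> + norm (f' z) * s + M * (b * s powr (1 + \<alpha>))" if "norm v \<le> 1" for v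
    proof -
      have s: "norm (x + v - z) \<le> s"
        using norm_triangle_ineq[of "x - z" v] that by (simp add: s_def algebra_simps)
      have "\<bar>f' z (x + v - z)\<bar> \<le> norm (f' z) * s"
        using norm_blinfun[of "f' z" "x + v - z"] s
        by (smt (verit) mult_left_mono norm_ge_zero real_norm_def)
      moreover have "M * \<phi> (x + v - z) \<le> M * (b * s powr (1 + \<alpha>))"
        using \<phi>_upper[of "x + v - z"] powr_mono2[of "1 + \<alpha>" _ s, OF _ _ s] \<open>0 < \<alpha>\<close> \<open>b > 0\<close> \<open>M > 0\<close>
        by (smt (verit) mult_left_mono norm_ge_zero)
      ultimately show ?thesis
        using F_between[OF \<open>z \<in> U\<close>, of "x + v"] by (simp add: p_def)
    qed
    then show "\<exists>\<delta>>0. \<exists>B. \<forall>v. norm v \<le> \<delta> \<longrightarrow> \<bar>F (x + v)\<bar> \<le> B"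
      by (intro exI[of _ 1] conjI exI allI impI) auto
  qed
  ultimately show ?thesis by blast
qed

end
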